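(* Let $b\ge 2$ be an integer. Let $d_1,d_2,d_3,\dots$ be independent random variables with $d_1$ uniform on $\{1,\dots,b-1\}$ and $d_j$ uniform on $\{0,1,\dots,b-1\}$ for $j\ge 2$. Put $s_0=0$ and $s_k=d_1+\dots+d_k$ for $k\ge 1$. For integers $n,k\ge 0$ let $A_b(n,k)$ be the probability that $s_k=n$ and $s_j\neq n$ for all $0\le j<k$. Then, as formal power series in $x$ and $t$, $$\sum_{n=0}^{\infty}\sum_{k=0}^{\infty}A_b(n,k)\,x^n t^k = 1+\frac{x(1-x^{b-1})}{(b-1)(1-x)}\,t+\frac{\left(1-x^{b-1}\right)^2x^2t^2}{\left(t\,x^b-bx+b-t\right)(b-1)(1-x)}.$$
   Context: The sequence $d_1,d_2,\dots$ models the digits of a random real number in base $b$: a uniformly random string of members of $\{0,1,\dots,b-1\}$ whose first digit is conditioned to be nonzero. Thus $A_b(n,k)$ is the probability that the $k$-th partial sum of the digits equals $n$ for the first time. *)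

theory Defs
  imports
    "HOL-Probability.Probability"
    "HOL-Computational_Algebra.Formal_Power_Series"
begin

(* The digits are d 1, d 2, ...; the value d 0 is never used. *)
definition digit_sum :: "(nat \<Rightarrow> 'a \<Rightarrow> nat) \<Rightarrow> nat \<Rightarrow> 'a \<Rightarrow> nat" where
  "digit_sum d k \<omega> = (\<Sum>i = 1..k. d i \<omega>)"

definition first_hit_prob :: "'a measure \<Rightarrow> (nat \<Rightarrow> 'a \<Rightarrow> nat) \<Rightarrow> nat \<Rightarrow> nat \<Rightarrow> real" where
  "first_hit_prob M d n k =
     measure M {\<omega> \<in> space M. digit_sum d k \<omega> = n \<and> (\<forall>j<k. digit_sum d j \<omega> \<noteq> n)}"

(* R[[x,t]] is represented as R[[x]][[t]]: the outer variable is t, the inner one is x. *)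
type_synonym fps2 = "real fps fps"

definition var_x :: fps2 where
  "var_x = fps_const fps_X"

definition var_t :: fps2 where
  "var_t = fps_X"

(* The series with coefficient a n k at x^n t^k. *)
definition double_fps :: "(nat \<Rightarrow> nat \<Rightarrow> real) \<Rightarrow> fps2" where
  "double_fps a = Abs_fps (\<lambda>k. Abs_fps (\<lambda>n. a n k))"

lemma fps_nth_monomial:
  "fps_nth (fps_nth (var_x ^ n * var_t ^ k) k') n' = (if n' = n \<and> k' = k then 1 else 0)"
  by (simp add: var_x_def var_t_def fps_const_power fps_X_power_iff
      fps_mult_left_const_nth)

(* Since real fps is not a field, division on fps2 need not be an inverse of multiplication.
   It is one when the divisor has nonzero constant coefficient, as is the case for the
   denominators of interest (denominators_units). *)
lemma fps2_divide_cancel: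
  fixes f g :: fps2
  assumes "fps_nth (fps_nth g 0) 0 \<noteq> 0"
  shows "f / g * g = f"
proof -
  have nz: "fps_nth g 0 \<noteq> 0"
    using assms by auto
  have "g * inverse g = 1"
    using fps_right_inverse[OF inverse_mult_eq_1'[OF assms]]
    by (simp only: fps_inverse_def[of g])
  then have "f * inverse g * g = f"
    by (simp add: mult.assoc mult.commute[of g])
  with nz show ?thesis
    by (simp add: fps_divide_unit)
qed

lemma denominators_units:
  fixes b :: nat
  assumes "b \<ge> 2"
  shows "fps_nth (fps_nth ((of_nat b - 1) * (1 - var_x)) 0) 0 \<noteq> 0"
    and "fps_nth (fps_nth ((var_t * var_x ^ b - of_nat b * var_x + of_nat b - var_t)
           * (of_nat b - 1) * (1 - var_x)) 0) 0 \<noteq> 0"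
  using assms
  by (simp_all add: var_x_def var_t_def fps_of_nat[symmetric])

end

theory Submission
  imports Defs
begin

text \<open>
  The partial sums never decrease, so the sum is a given \<open>n\<close> for the first time at step \<open>k + 1\<close>
  exactly when it equals \<open>n\<close> after \<open>k + 1\<close> digits and the last digit is nonzero.  Since the last
  digit is independent of the sum before it, the series in \<open>x\<close> of the first-hit probabilities is
  the generating function of the sum of the first \<open>k\<close> digits times that of the last digit without
  its constant term (\<open>first_hit_prob_gen_fun\<close>).

  Let \<open>u\<close> and \<open>v\<close> be the generating functions of the first digit and of a later digit, and
  \<open>w = v - 1/b\<close>.  The coefficients of \<open>t^0\<close>, \<open>t^1\<close> and \<open>t^(k+2)\<close> are then \<open>1\<close>, \<open>u\<close> and
  \<open>u v^k w\<close>, and the geometric series sums to \<open>1 + u t + u w t^2 / (1 - v t)\<close>.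
  Multiplied by \<open>b (1 - x)\<close>, both \<open>v\<close> and \<open>w\<close> become polynomials, \<open>1 - x^b\<close> and
  \<open>x (1 - x^(b-1))\<close>.  This also turns \<open>1 - v t\<close> into \<open>t x^b - b x + b - t\<close>, the first factor of the
  stated denominator.  Likewise \<open>u (b - 1) (1 - x) = x (1 - x^(b-1))\<close>.  All identities
  are proved in this denominator-free form, because an equation \<open>h g = f\<close> with \<open>g\<close> a unit
  determines the quotient \<open>f / g\<close> (\<open>fps2_divide_eqI\<close>).
\<close>

section \<open>Generating functions of sums and of first hits\<close>

definition prob_gen_fun :: "'a measure \<Rightarrow> ('a \<Rightarrow> nat) \<Rightarrow> real fps" where
  "prob_gen_fun M X = Abs_fps (\<lambda>n. measure M {\<omega> \<in> space M. X \<omega> = n})"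

lemma (in prob_space) indep_var_sum_last:
  fixes X :: "'i \<Rightarrow> 'a \<Rightarrow> nat"
  assumes "finite I" "i \<notin> I"
    and ind: "indep_vars (\<lambda>_. count_space UNIV) X (insert i I)"
  shows "indep_var (count_space UNIV) (\<lambda>\<omega>. \<Sum>j\<in>I. X j \<omega>) (count_space UNIV) (X i)"
proof -
  let ?N = "\<lambda>J. PiM J (\<lambda>_. count_space (UNIV :: nat set))"
  have "indep_var (?N I) (\<lambda>\<omega>. restrict (\<lambda>j. X j \<omega>) I)
          (?N {i}) (\<lambda>\<omega>. restrict (\<lambda>j. X j \<omega>) {i})"
    using assms by (intro indep_var_restrict[OF ind]) auto
  then have "indep_var (count_space UNIV) ((\<lambda>f. \<Sum>j\<in>I. f j) \<circ> (\<lambda>\<omega>. restrict (\<lambda>j. X j \<omega>) I))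
          (count_space UNIV) ((\<lambda>f. f i) \<circ> (\<lambda>\<omega>. restrict (\<lambda>j. X j \<omega>) {i}))"
    by (rule indep_var_compose) measurable
  also have "(\<lambda>f. \<Sum>j\<in>I. f j) \<circ> (\<lambda>\<omega>. restrict (\<lambda>j. X j \<omega>) I) = (\<lambda>\<omega>. \<Sum>j\<in>I. X j \<omega>)"
    by (auto simp: o_def)
  also have "(\<lambda>f. f i) \<circ> (\<lambda>\<omega>. restrict (\<lambda>j. X j \<omega>) {i}) = X i"
    by auto
  finally show ?thesis .
qed

lemma (in prob_space) prob_indep_pair:
  fixes X Y :: "'a \<Rightarrow> nat"
  assumes "indep_var (count_space UNIV) X (count_space UNIV) Y"
  shows "prob {\<omega> \<in> space M. X \<omega> = m \<and> Y \<omega> = n} =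
    prob {\<omega> \<in> space M. X \<omega> = m} * prob {\<omega> \<in> space M. Y \<omega> = n}"
proof -
  have "prob ((\<lambda>\<omega>. (X \<omega>, Y \<omega>)) -` ({m} \<times> {n}) \<inter> space M) =
      prob (X -` {m} \<inter> space M) * prob (Y -` {n} \<inter> space M)"
    using assms by (intro indep_varD) auto
  moreover have "(\<lambda>\<omega>. (X \<omega>, Y \<omega>)) -` ({m} \<times> {n}) \<inter> space M = {\<omega> \<in> space M. X \<omega> = m \<and> Y \<omega> = n}"
    "X -` {m} \<inter> space M = {\<omega> \<in> space M. X \<omega> = m}"
    "Y -` {n} \<inter> space M = {\<omega> \<in> space M. Y \<omega> = n}"
    by auto
  ultimately show ?thesis by simp
qed

text \<open>
  The Cauchy product is the convolution of the two laws: split the event \<open>X + Y = n\<close> according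
  to the value of \<open>X\<close>.
\<close>
lemma (in prob_space) prob_gen_fun_add:
  fixes X Y :: "'a \<Rightarrow> nat"
  assumes ind: "indep_var (count_space UNIV) X (count_space UNIV) Y"
  shows "prob_gen_fun M (\<lambda>\<omega>. X \<omega> + Y \<omega>) = prob_gen_fun M X * prob_gen_fun M Y"
proof (rule fps_ext)
  fix n
  have [measurable]: "X \<in> measurable M (count_space UNIV)" "Y \<in> measurable M (count_space UNIV)"
    using indep_var_rv1[OF ind] indep_var_rv2[OF ind] by auto
  have "{\<omega> \<in> space M. X \<omega> + Y \<omega> = n} = (\<Union>i\<in>{0..n}. {\<omega> \<in> space M. X \<omega> = i \<and> Y \<omega> = n - i})"
    by auto
  then have "prob {\<omega> \<in> space M. X \<omega> + Y \<omega> = n} =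
      prob (\<Union>i\<in>{0..n}. {\<omega> \<in> space M. X \<omega> = i \<and> Y \<omega> = n - i})"
    by simp
  also have "\<dots> = (\<Sum>i = 0..n. prob {\<omega> \<in> space M. X \<omega> = i \<and> Y \<omega> = n - i})"
    by (rule finite_measure_finite_Union) (auto simp: disjoint_family_on_def)
  finally show "fps_nth (prob_gen_fun M (\<lambda>\<omega>. X \<omega> + Y \<omega>)) n =
      fps_nth (prob_gen_fun M X * prob_gen_fun M Y) n"
    by (simp add: prob_gen_fun_def fps_mult_nth prob_indep_pair[OF ind])
qed

text \<open>
  A sum equal to \<open>n\<close> after \<open>k + 1\<close> digits fails to be a first hit only if it was already \<open>n\<close>
  after \<open>k\<close> digits and the next digit is 0: by monotonicity, a value \<open>n\<close> taken earlier persists.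
  By independence this exceptional event contributes the constant coefficient of the last
  digit's generating function, which is what the second identity subtracts.  The case \<open>k = 0\<close>
  is covered with the empty sum in place of the earlier digits.
\<close>
lemma (in prob_space) digit_sum_first_hit_gen_fun:
  fixes d :: "nat \<Rightarrow> 'a \<Rightarrow> nat"
  assumes ind: "indep_vars (\<lambda>_. count_space UNIV) d {1..}"
  defines "S \<equiv> \<lambda>k. prob_gen_fun M (digit_sum d k)"
    and "Q \<equiv> \<lambda>k. prob_gen_fun M (d k)"
  shows digit_sum_prob_gen_fun: "S (Suc k) = S k * Q (Suc k)"
    and first_hit_prob_gen_fun:
      "Abs_fps (\<lambda>n. first_hit_prob M d n (Suc k)) =
         S k * (Q (Suc k) - fps_const (fps_nth (Q (Suc k)) 0))"
proof -
  have "indep_vars (\<lambda>_. count_space UNIV) d (insert (Suc k) {1..k})"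
    by (rule indep_vars_subset[OF ind]) auto
  then have kind: "indep_var (count_space UNIV) (digit_sum d k) (count_space UNIV) (d (Suc k))"
    using indep_var_sum_last[of "{1..k}" "Suc k" d] unfolding digit_sum_def[abs_def] by simp
  have [measurable]: "digit_sum d k \<in> measurable M (count_space UNIV)"
      "d (Suc k) \<in> measurable M (count_space UNIV)"
    using indep_var_rv1[OF kind] indep_var_rv2[OF kind] by auto
  have step: "digit_sum d (Suc k) = (\<lambda>\<omega>. digit_sum d k \<omega> + d (Suc k) \<omega>)"
    by (simp add: digit_sum_def fun_eq_iff)
  show S: "S (Suc k) = S k * Q (Suc k)"
    unfolding S_def Q_def step by (rule prob_gen_fun_add[OF kind])
  show "Abs_fps (\<lambda>n. first_hit_prob M d n (Suc k)) =
      S k * (Q (Suc k) - fps_const (fps_nth (Q (Suc k)) 0))"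
  proof (rule fps_ext)
    fix n
    let ?E = "{\<omega> \<in> space M. digit_sum d (Suc k) \<omega> = n}"
    let ?F = "{\<omega> \<in> space M. digit_sum d k \<omega> = n \<and> d (Suc k) \<omega> = 0}"
    have mono: "digit_sum d j \<omega> \<le> digit_sum d k \<omega>" if "j \<le> k" for j \<omega>
      unfolding digit_sum_def using that by (intro sum_mono2) auto
    have "{\<omega> \<in> space M. digit_sum d (Suc k) \<omega> = n \<and> (\<forall>j<Suc k. digit_sum d j \<omega> \<noteq> n)} = ?E - ?F"
    proof (intro equalityI subsetI)
      fix \<omega>
      assume \<omega>: "\<omega> \<in> ?E - ?F"
      have "digit_sum d j \<omega> \<noteq> n" if "j < Suc k" for j
      proof -
        have "digit_sum d k \<omega> < n"
          using \<omega> by (auto simp: step)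
        then show ?thesis
          using mono[of j \<omega>] that by simp
      qed
      then show "\<omega> \<in> {\<omega> \<in> space M. digit_sum d (Suc k) \<omega> = n \<and> (\<forall>j<Suc k. digit_sum d j \<omega> \<noteq> n)}"
        using \<omega> by simp
    qed auto
    moreover have "prob (?E - ?F) = prob ?E - prob ?F"
      by (rule finite_measure_Diff) (auto simp: step)
    ultimately have "first_hit_prob M d n (Suc k) = fps_nth (S (Suc k)) n - fps_nth (S k) n * fps_nth (Q (Suc k)) 0"
      by (simp add: first_hit_prob_def prob_indep_pair[OF kind] S_def Q_def prob_gen_fun_def)
    then show "fps_nth (Abs_fps (\<lambda>n. first_hit_prob M d n (Suc k))) n =
        fps_nth (S k * (Q (Suc k) - fps_const (fps_nth (Q (Suc k)) 0))) n"
      by (simp add: S right_diff_distrib)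
  qed
qed

section \<open>Generating functions of the digits\<close>

lemma prob_gen_fun_distr_pmf:
  assumes "X \<in> measurable M (count_space UNIV)"
    and "distr M (count_space UNIV) X = measure_pmf p"
  shows "prob_gen_fun M X = Abs_fps (pmf p)"
proof (rule fps_ext)
  fix n
  have "pmf p n = measure (distr M (count_space UNIV) X) {n}"
    by (simp add: assms(2) pmf.rep_eq)
  also have "\<dots> = measure M {\<omega> \<in> space M. X \<omega> = n}"
    using assms(1) by (subst measure_distr) (auto intro!: arg_cong[of _ _ "measure M"])
  finally show "fps_nth (prob_gen_fun M X) n = fps_nth (Abs_fps (pmf p)) n"
    by (simp add: prob_gen_fun_def)
qed

text \<open>
  Up to its normalisation the generating function is a finite geometric sum, which \<open>1 - x\<close>
  telescopes.
\<close>
lemma uniform_gen_fun_times_denominator: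
  fixes m n :: nat
  assumes "m \<le> n"
  shows "Abs_fps (pmf (pmf_of_set {m..n})) * (of_nat (Suc n - m) * (1 - fps_X)) =
    fps_X ^ m - fps_X ^ Suc n"
proof -
  have "Abs_fps (pmf (pmf_of_set {m..n})) * of_nat (Suc n - m) = (\<Sum>i=m..n. fps_X ^ i)"
    using assms
    by (intro fps_ext)
      (simp add: pmf_of_set fps_sum_nth fps_X_power_iff fps_of_nat[symmetric]
        fps_mult_right_const_nth indicator_def del: of_nat_Suc of_nat_diff)
  then show ?thesis
    using sum_gp_multiplied[OF assms, of "fps_X :: real fps"]
    by (metis mult.assoc mult.commute)
qed

section \<open>Summation over the number of digits\<close>

lemma double_fps_eq_geometric:
  fixes u v w :: "real fps"
  assumes "Abs_fps (\<lambda>n. a n 0) = 1" "Abs_fps (\<lambda>n. a n 1) = u"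
    and "\<And>k. Abs_fps (\<lambda>n. a n (Suc (Suc k))) = u * v ^ k * w"
  shows "double_fps a =
    1 + fps_const u * var_t + fps_const (u * w) * var_t\<^sup>2 * Abs_fps (\<lambda>k. v ^ k)"
proof (rule fps_ext)
  fix k
  show "fps_nth (double_fps a) k = fps_nth
    (1 + fps_const u * var_t + fps_const (u * w) * var_t\<^sup>2 * Abs_fps (\<lambda>k. v ^ k)) k"
  proof (cases k)
    case 0
    then show ?thesis using assms(1)
      by (simp add: double_fps_def var_t_def power2_eq_square mult.assoc)
  next
    case (Suc j)
    then show ?thesis
      using assms(2) assms(3)[of "j - 1"]
      by (cases j) (simp_all add: double_fps_def var_t_def power2_eq_square mult_ac)
  qed
qed

text \<open>
  Division of series over the non-field \<open>real fps\<close> is total and not always meaningful; for a unit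
  divisor it is characterised by cross-multiplication.
\<close>
lemma fps2_divide_eqI:
  fixes f g h :: fps2
  assumes "fps_nth (fps_nth g 0) 0 \<noteq> 0" "h * g = f"
  shows "f / g = h"
proof -
  have "f / g * g = h * g"
    using fps2_divide_cancel[OF assms(1)] assms(2) by simp
  moreover have "g \<noteq> 0"
    using assms(1) by auto
  ultimately show ?thesis
    by simp
qed

lemma geometric_fps_inverse:
  fixes v :: "'a :: comm_ring_1"
  shows "Abs_fps (\<lambda>k. v ^ k) * (1 - fps_const v * fps_X) = 1"
proof (rule fps_ext)
  fix k
  have "Abs_fps (\<lambda>k. v ^ k) * (1 - fps_const v * fps_X) =
      Abs_fps (\<lambda>k. v ^ k) - fps_const v * (fps_X * Abs_fps (\<lambda>k. v ^ k))"
    by (simp add: algebra_simps)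
  then show "fps_nth (Abs_fps (\<lambda>k. v ^ k) * (1 - fps_const v * fps_X)) k = fps_nth 1 k"
    by (cases k) simp_all
qed

theorem theorem2:
  fixes b :: nat and M :: "'a measure" and d :: "nat \<Rightarrow> 'a \<Rightarrow> nat"
  assumes "b \<ge> 2"
    and "prob_space M"
    and "prob_space.indep_vars M (\<lambda>_. count_space UNIV) d {1..}"
    and "distr M (count_space UNIV) (d 1) = measure_pmf (pmf_of_set {1..b - 1})"
    and "\<And>j. j \<ge> 2 \<Longrightarrow>
           distr M (count_space UNIV) (d j) = measure_pmf (pmf_of_set {0..b - 1})"
  shows "double_fps (first_hit_prob M d) =
    1 + var_x * (1 - var_x ^ (b - 1)) / ((of_nat b - 1) * (1 - var_x)) * var_t
      + (1 - var_x ^ (b - 1))\<^sup>2 * var_x\<^sup>2 * var_t\<^sup>2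
        / ((var_t * var_x ^ b - of_nat b * var_x + of_nat b - var_t)
           * (of_nat b - 1) * (1 - var_x))"
proof -
  interpret prob_space M by fact
  have Suc_b: "Suc (b - 1) = b"
    using assms(1) by simp
  define S where "S = (\<lambda>k. prob_gen_fun M (digit_sum d k))"
  define u where "u = Abs_fps (pmf (pmf_of_set {1..b - 1}))"
  define v where "v = Abs_fps (pmf (pmf_of_set {0..b - 1}))"
  define w where "w = v - fps_const (fps_nth v 0)"
  have rv: "d j \<in> measurable M (count_space UNIV)" if "j \<ge> 1" for j
    using assms(3) that by (auto simp: indep_vars_def)
  have d1: "prob_gen_fun M (d (Suc 0)) = u"
    using prob_gen_fun_distr_pmf[OF rv assms(4)] by (simp add: u_def)
  have d2: "prob_gen_fun M (d (Suc (Suc k))) = v" for k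
    using prob_gen_fun_distr_pmf[OF rv assms(5)] by (simp add: v_def)
  have S0: "S 0 = 1"
    by (intro fps_ext) (simp add: S_def prob_gen_fun_def digit_sum_def prob_space)
  have S: "S (Suc k) = u * v ^ k" for k
  proof (induction k)
    case 0
    show ?case
      using digit_sum_prob_gen_fun[OF assms(3), of 0] S0 d1 by (simp add: S_def)
  next
    case (Suc k)
    then show ?case
      using digit_sum_prob_gen_fun[OF assms(3), of "Suc k"] d2 by (simp add: S_def mult_ac)
  qed
  \<comment> \<open>The first digit is never 0, so every value reached after one digit is a first hit there.\<close>
  have u0: "fps_nth u 0 = 0"
    using assms(1) by (simp add: u_def)
  have A0: "Abs_fps (\<lambda>n. first_hit_prob M d n 0) = 1"
    by (intro fps_ext) (simp add: first_hit_prob_def digit_sum_def prob_space)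
  have A1: "Abs_fps (\<lambda>n. first_hit_prob M d n 1) = u"
    using first_hit_prob_gen_fun[OF assms(3), of 0] S0 d1 u0 by (simp add: S_def)
  have A2: "Abs_fps (\<lambda>n. first_hit_prob M d n (Suc (Suc k))) = u * v ^ k * w" for k
    using first_hit_prob_gen_fun[OF assms(3), of "Suc k"] S[of k] d2 by (simp add: S_def w_def)

  have u_eq: "u * ((of_nat b - 1) * (1 - fps_X)) = fps_X * (1 - fps_X ^ (b - 1))"
    using uniform_gen_fun_times_denominator[of 1 "b - 1"] assms(1)
    by (simp add: u_def right_diff_distrib flip: power_Suc)
  have v_eq: "v * (of_nat b * (1 - fps_X)) = 1 - fps_X ^ b"
    using uniform_gen_fun_times_denominator[of 0 "b - 1"] assms(1) by (simp add: v_def Suc_b del: power_Suc)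
  have v0: "fps_const (fps_nth v 0) * of_nat b = 1"
    using assms(1) by (simp add: v_def pmf_of_set fps_of_nat[symmetric])
  have "w * (of_nat b * (1 - fps_X)) =
      v * (of_nat b * (1 - fps_X)) - fps_const (fps_nth v 0) * of_nat b * (1 - fps_X)"
    by (simp add: w_def left_diff_distrib mult.assoc)
  also have "\<dots> = fps_X * (1 - fps_X ^ (b - 1))"
    unfolding v_eq v0 using assms(1) by (simp add: right_diff_distrib flip: power_Suc)
  finally have w_eq: "w * (of_nat b * (1 - fps_X)) = fps_X * (1 - fps_X ^ (b - 1))" .

  \<comment> \<open>The same series in two variables, constant in \<open>t\<close>; \<open>G\<close> is \<open>1 / (1 - v t)\<close>.\<close>
  define U V W G where "U = fps_const u" and "V = fps_const v" and "W = fps_const w"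
    and "G = Abs_fps (\<lambda>k. v ^ k)"
  have lift: "of_nat b = fps_const (of_nat b :: real fps)" "(1 :: fps2) = fps_const 1"
    by (simp_all add: fps_of_nat)
  have U: "U * ((of_nat b - 1) * (1 - var_x)) = var_x * (1 - var_x ^ (b - 1))"
    unfolding U_def lift var_x_def using u_eq by (simp add: fps_const_power mult_ac)
  have V: "V * (of_nat b * (1 - var_x)) = 1 - var_x ^ b"
    unfolding V_def lift var_x_def using v_eq by (simp add: fps_const_power mult_ac)
  have W: "W * (of_nat b * (1 - var_x)) = var_x * (1 - var_x ^ (b - 1))"
    unfolding W_def lift var_x_def using w_eq by (simp add: fps_const_power mult_ac)
  have G: "G * (1 - V * var_t) = 1"
    unfolding G_def V_def var_t_def by (rule geometric_fps_inverse)
  have "var_t * var_x ^ b - of_nat b * var_x + of_nat b - var_t =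
      of_nat b * (1 - var_x) - (1 - var_x ^ b) * var_t"
    by (simp add: algebra_simps)
  also have "\<dots> = of_nat b * (1 - var_x) * (1 - V * var_t)"
    unfolding V[symmetric] by (simp add: algebra_simps)
  finally have D: "var_t * var_x ^ b - of_nat b * var_x + of_nat b - var_t =
      of_nat b * (1 - var_x) * (1 - V * var_t)" .
  have "U * W * var_t\<^sup>2 * G * (of_nat b * (1 - var_x) * (1 - V * var_t) * (of_nat b - 1) * (1 - var_x)) =
      (U * ((of_nat b - 1) * (1 - var_x))) * (W * (of_nat b * (1 - var_x))) * var_t\<^sup>2 * (G * (1 - V * var_t))"
    by (simp only: mult_ac)
  also have "\<dots> = (1 - var_x ^ (b - 1))\<^sup>2 * var_x\<^sup>2 * var_t\<^sup>2"
    unfolding U W G by (simp add: power2_eq_square mult_ac)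
  finally have UWG: "(1 - var_x ^ (b - 1))\<^sup>2 * var_x\<^sup>2 * var_t\<^sup>2
        / ((var_t * var_x ^ b - of_nat b * var_x + of_nat b - var_t)
           * (of_nat b - 1) * (1 - var_x)) = U * W * var_t\<^sup>2 * G"
    using fps2_divide_eqI[OF denominators_units(2)[OF assms(1)]] unfolding D by blast
  have "double_fps (first_hit_prob M d) = 1 + U * var_t + U * W * var_t\<^sup>2 * G"
    using double_fps_eq_geometric[OF A0 A1 A2] by (simp add: U_def W_def G_def)
  then show ?thesis
    unfolding UWG fps2_divide_eqI[OF denominators_units(1)[OF assms(1)] U] .
qed

end
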